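(* Let $\Phi_N$ be the $N$-dimensional space of exponential polynomials defined in the context, and let $\{a^{[k]}(z),\ k\ge0\}$ be the symbols of a non-stationary subdivision scheme $\{S_{\mathbf a^{[k]}},\ k\ge0\}$ which is $\Phi_N$-generating and reproduces one exponential polynomial in $\Phi_N$. If $\{S_{\mathbf a^{[k]}},\ k\ge0\}$ is asymptotically similar to a convergent stationary subdivision scheme $\{S_{\mathbf a}\}$, and the Wronskian matrix $\mathcal W_{\Phi_N}(x)$ is invertible for all $x$ in a neighborhood of zero, then for $\beta=0,\dots,N-1$ $$|a^{[k]}(1)-2|=O(2^{-k})\qquad\text{and}\qquad\left|\frac{d^\beta a^{[k]}(-1)}{dz^\beta}\right|=O(2^{-k(N-\beta)}),\qquad k\to\infty.$$
   Context: Subdivision schemes. For each $k\ge 0$ let $\mathbf a^{[k]}=\{a^{[k]}_i\in\mathbb R,\ i\in\mathbb Z\}$ be a mask; all masks are supported in $\{-M,\dots,M\}$ for one fixed $M\in\mathbb N$. The subdivision operator is $(S_{\mathbf a^{[k]}}\mathbf f)_i=\sum_{j\in\mathbb Z}a^{[k]}_{i-2j}f_j$, $i\in\mathbb Z$. The (non-stationary) subdivision scheme $\{S_{\mathbf a^{[k]}},k\ge0\}$ produces from initial data $\mathbf f^{[0]}$ the sequences $\mathbf f^{[k]}=S_{\mathbf a^{[k-1]}}\cdots S_{\mathbf a^{[0]}}\mathbf f^{[0]}$. It is stationary, written $\{S_{\mathbf a}\}$, if all operators coincide. The symbols are $a^{[k]}(z)=\sum_i a_i^{[k]}z^i$, $z\in\mathbb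 C\setminus\{0\}$. The scheme is convergent if for every $\mathbf f^{[0]}\in\ell_\infty(\mathbb Z)$ there is a continuous function $g$ on $\mathbb R$ with $\lim_{k\to\infty}\sup_{i}|g(i2^{-k})-(\mathbf f^{[k]})_i|=0$; $g$ is the limit from $\mathbf f^{[0]}$. For unbounded data the limit is understood locally, which makes sense because the masks are finitely supported. Exponential polynomials. Let $\eta,N\in\mathbb N$, $\lambda_1,\dots,\lambda_\eta\in\mathbb C$, and $\mu_1,\dots,\mu_\eta\in\mathbb N$ with $\sum_n\mu_n=N$. $\Phi_N=\mathrm{span}\{x^\beta e^{\lambda_n x}:\beta=0,\dots,\mu_n-1,\ n=1,\dots,\eta\}$, spanned by $N$ linearly independent functions; these are listed as $\varphi_0,\dots,\varphi_{N-1}$. Parametrization. Level-$k$ data are attached to the grid points $t_i^{[k]}=(i+p)/2^k$, with shift parameter $p\in\{0,-\frac12\}$ (primal if $p=0$, dual if $p=-\frac12$). Generation. A convergent scheme is $\Phi_N$-generating if for every $f\in\Phi_N$ the limit from the initial data $\{f(t_i^{[0]}),i\in\mathbb Z\}$ belongs to $\Phi_N$; moreover, its symbols satisfy $a^{[k]}(z)=b^{[k]}(z)\prod_{n=1}^\eta(1+e^{\lambda_n2^{-k-1}}z)^{\mu_n}$ for all $k\ge0$ and some Laurent polynomials $b^{[k]}$. Reproduction of one exponential polynomial in $\Phi_N$. For some $n$ and some $0\le r\le\mu_n-1$, with $f(x)=x^re^{\lambda_nx}$, the limit from the data $\{f(t^{[0]}_i),i\in\mathbb Z\}$ equals $f$.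 As the paper observes, then $e^{\lambda x}$ with $\lambda=\lambda_n$ is reproduced as well, and this means on the symbols: $a^{[k]}(-r_k^{-1})=0$ and $a^{[k]}(r_k^{-1})=2r_k^{-p}$ for all $k\ge0$, where $r_k=e^{\lambda2^{-k-1}}$. Asymptotical similarity of $\{S_{\mathbf a^{[k]}},k\ge0\}$ to $\{S_{\mathbf a}\}$: $\lim_{k\to\infty}\|\mathbf a^{[k]}-\mathbf a\|=0$, with $\|\cdot\|$ the supremum norm of sequences; $\mathbf a$ is also supported in $\{-M,\dots,M\}$. Wronskian matrix: $\mathcal W_{\Phi_N}(x)=\left(\frac1{\beta!}\frac{d^\beta\varphi_\alpha(x)}{dx^\beta}\right)_{\alpha,\beta=0,\dots,N-1}$. *)

theory Defs
  imports
    "HOL-Analysis.Analysis"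
    "HOL-Library.Landau_Symbols"
    "HOL-Library.Function_Algebras"
    "Jordan_Normal_Form.Matrix"
begin

section \<open>Subdivision schemes\<close>

text \<open>
  Masks are real bi-infinite sequences and a scheme is the sequence of its level masks.  Data are
  complex, because the exponential polynomials below are complex-valued.  The index set of the sum
  is finite for finitely supported masks.
\<close>

definition subdiv_op :: "(int \<Rightarrow> real) \<Rightarrow> (int \<Rightarrow> complex) \<Rightarrow> int \<Rightarrow> complex" where
  "subdiv_op a f i = (\<Sum>j | a (i - 2 * j) \<noteq> 0. of_real (a (i - 2 * j)) * f j)"

primrec subdiv_seq :: "(nat \<Rightarrow> int \<Rightarrow> real) \<Rightarrow> (int \<Rightarrow> complex) \<Rightarrow> nat \<Rightarrow> int \<Rightarrow> complex" where
  "subdiv_seq A f 0 = f"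
| "subdiv_seq A f (Suc k) = subdiv_op (A k) (subdiv_seq A f k)"

text \<open>
  The suprema are taken in \<^typ>\<open>ennreal\<close>, so that an unbounded deviation has supremum \<open>\<infinity>\<close> and the
  empty supremum is \<open>0\<close>.
\<close>

definition subdiv_deviation ::
    "(nat \<Rightarrow> int \<Rightarrow> real) \<Rightarrow> (int \<Rightarrow> complex) \<Rightarrow> (real \<Rightarrow> complex) \<Rightarrow> real set \<Rightarrow> nat \<Rightarrow> ennreal" where
  "subdiv_deviation A f g K k =
     (SUP i\<in>{i. of_int i / 2 ^ k \<in> K}. ennreal (cmod (g (of_int i / 2 ^ k) - subdiv_seq A f k i)))"

definition subdiv_limit ::
    "(nat \<Rightarrow> int \<Rightarrow> real) \<Rightarrow> (int \<Rightarrow> complex) \<Rightarrow> (real \<Rightarrow> complex) \<Rightarrow> bool" where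
  "subdiv_limit A f g \<longleftrightarrow> continuous_on UNIV g \<and> subdiv_deviation A f g UNIV \<longlonglongrightarrow> 0"

definition subdiv_local_limit ::
    "(nat \<Rightarrow> int \<Rightarrow> real) \<Rightarrow> (int \<Rightarrow> complex) \<Rightarrow> (real \<Rightarrow> complex) \<Rightarrow> bool" where
  "subdiv_local_limit A f g \<longleftrightarrow>
     continuous_on UNIV g \<and> (\<forall>K. compact K \<longrightarrow> subdiv_deviation A f g K \<longlonglongrightarrow> 0)"

definition subdiv_convergent :: "(nat \<Rightarrow> int \<Rightarrow> real) \<Rightarrow> bool" where
  "subdiv_convergent A \<longleftrightarrow> (\<forall>f. bounded (range f) \<longrightarrow> (\<exists>g. subdiv_limit A f g))"

definition asymptotically_similar :: "(nat \<Rightarrow> int \<Rightarrow> real) \<Rightarrow> (int \<Rightarrow> real) \<Rightarrow> bool" where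
  "asymptotically_similar A a \<longleftrightarrow> (\<lambda>k. SUP i. ennreal \<bar>A k i - a i\<bar>) \<longlonglongrightarrow> 0"

definition laurent_eval :: "(int \<Rightarrow> complex) \<Rightarrow> complex \<Rightarrow> complex" where
  "laurent_eval c z = (\<Sum>i | c i \<noteq> 0. c i * z powi i)"

definition mask_symbol :: "(int \<Rightarrow> real) \<Rightarrow> complex \<Rightarrow> complex" where
  "mask_symbol a = laurent_eval (\<lambda>i. of_real (a i))"


section \<open>Exponential polynomials\<close>

global_interpretation cfun: vector_space "\<lambda>(c::complex) (f :: real \<Rightarrow> complex) x. c * f x"
  defines cfun_span = cfun.span and cfun_independent = "\<lambda>S. \<not> cfun.dependent S"
  by unfold_locales (auto simp: fun_eq_iff algebra_simps)

definition exp_monom :: "complex \<Rightarrow> nat \<Rightarrow> real \<Rightarrow> complex" where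
  "exp_monom l \<beta> x = of_real x ^ \<beta> * exp (l * of_real x)"

definition exp_monoms :: "nat \<Rightarrow> (nat \<Rightarrow> complex) \<Rightarrow> (nat \<Rightarrow> nat) \<Rightarrow> (real \<Rightarrow> complex) set" where
  "exp_monoms \<eta> lam \<mu> = {exp_monom (lam n) \<beta> | n \<beta>. n \<in> {1..\<eta>} \<and> \<beta> < \<mu> n}"

definition exp_poly_space :: "nat \<Rightarrow> (nat \<Rightarrow> complex) \<Rightarrow> (nat \<Rightarrow> nat) \<Rightarrow> (real \<Rightarrow> complex) set" where
  "exp_poly_space \<eta> lam \<mu> = cfun_span (exp_monoms \<eta> lam \<mu>)"

definition wronskian :: "nat \<Rightarrow> (nat \<Rightarrow> real \<Rightarrow> complex) \<Rightarrow> real \<Rightarrow> complex mat" where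
  "wronskian N \<phi> x =
     mat N N (\<lambda>(\<alpha>, \<beta>). ((\<lambda>f y. vector_derivative f (at y)) ^^ \<beta>) (\<phi> \<alpha>) x / fact \<beta>)"


section \<open>Generation and reproduction\<close>

definition grid_point :: "real \<Rightarrow> nat \<Rightarrow> int \<Rightarrow> real" where
  "grid_point p k i = (of_int i + p) / 2 ^ k"

text \<open>
  The notion of generation includes the factorization of the symbols at every level, with arbitrary
  (complex) Laurent polynomial cofactors.
\<close>

definition generating ::
    "(nat \<Rightarrow> int \<Rightarrow> real) \<Rightarrow> real \<Rightarrow> nat \<Rightarrow> (nat \<Rightarrow> complex) \<Rightarrow> (nat \<Rightarrow> nat) \<Rightarrow> bool" where
  "generating A p \<eta> lam \<mu> \<longleftrightarrow>
     subdiv_convergent A \<and>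
     (\<forall>f \<in> exp_poly_space \<eta> lam \<mu>. \<exists>g \<in> exp_poly_space \<eta> lam \<mu>.
        subdiv_local_limit A (\<lambda>i. f (grid_point p 0 i)) g) \<and>
     (\<forall>k. \<exists>b. finite {i. b i \<noteq> 0} \<and>
        (\<forall>z. z \<noteq> 0 \<longrightarrow> mask_symbol (A k) z =
           laurent_eval b z * (\<Prod>n=1..\<eta>. (1 + exp (lam n / 2 ^ (k + 1)) * z) ^ \<mu> n)))"

text \<open>
  Reproduction in the limit only constrains the product of all levels; the two symbol identities say
  that every single level reproduces \<open>e\<^sup>\<lambda>\<^sup>x\<close>.  The power \<open>r\<^sub>k\<^sup>-\<^sup>p\<close> of \<open>r\<^sub>k = exp (\<lambda> / 2\<^sup>k\<^sup>+\<^sup>1)\<close>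
  is \<open>exp (-p \<lambda> / 2\<^sup>k\<^sup>+\<^sup>1)\<close>: this is the branch that matches the samples of \<open>e\<^sup>\<lambda>\<^sup>x\<close> at the grid
  points, and it differs from the principal branch when \<open>Im \<lambda>\<close> is large.
\<close>

definition reproduces_one ::
    "(nat \<Rightarrow> int \<Rightarrow> real) \<Rightarrow> real \<Rightarrow> nat \<Rightarrow> (nat \<Rightarrow> complex) \<Rightarrow> (nat \<Rightarrow> nat) \<Rightarrow> bool" where
  "reproduces_one A p \<eta> lam \<mu> \<longleftrightarrow>
     (\<exists>n \<in> {1..\<eta>}. \<exists>r < \<mu> n.
        subdiv_local_limit A (\<lambda>i. exp_monom (lam n) r (grid_point p 0 i)) (exp_monom (lam n) r) \<and>
        (\<forall>k. mask_symbol (A k) (- inverse (exp (lam n / 2 ^ (k + 1)))) = 0 \<and>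
             mask_symbol (A k) (inverse (exp (lam n / 2 ^ (k + 1)))) =
               2 * exp (- of_real p * lam n / 2 ^ (k + 1))))"

end

theory Submission
  imports
    Defs
    "HOL-Complex_Analysis.Complex_Analysis"
begin

text \<open>
  Up to the unit \<open>z\<^sup>M\<close> the level symbols are polynomials \<open>P\<^sub>k\<close> of degree at most \<open>2M\<close>, and
  asymptotical similarity bounds their coefficients uniformly in \<open>k\<close>.  Write \<open>\<epsilon> = 2\<^sup>-\<^sup>k\<close>.

  \<^emph>\<open>At \<open>z = 1\<close>.\<close>  The point \<open>r\<^sub>k\<^sup>-\<^sup>1 = exp (-\<lambda> / 2\<^sup>k\<^sup>+\<^sup>1)\<close> has distance \<open>O(\<epsilon>)\<close> from \<open>1\<close>, and symbols
  with uniformly bounded coefficients and fixed support are uniformly Lipschitz there.  So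
  \<open>a\<^sup>[\<^sup>k\<^sup>](1)\<close> differs by \<open>O(\<epsilon>)\<close> from the prescribed value \<open>2 r\<^sub>k\<^sup>-\<^sup>p\<close>, which is \<open>2 + O(\<epsilon>)\<close>.

  \<^emph>\<open>At \<open>z = -1\<close>.\<close>  Generation says that \<open>P\<^sub>k\<close> is divisible by \<open>N\<close> linear factors \<open>1 + r z\<close>, whose
  values at \<open>-1\<close> are \<open>O(\<epsilon>)\<close>.  Each derivative can destroy at most one of these small factors, so
  that the \<open>\<beta>\<close>-th derivative is \<open>O(\<epsilon>\<^sup>N\<^sup>-\<^sup>\<beta>)\<close>, provided that the cofactor stays bounded as \<open>k\<close> grows.
  It does: a factor \<open>1 + r z\<close> has constant term \<open>1\<close>, so dividing by it is the triangular recursion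
  \<open>q\<^sub>i = p\<^sub>i - r q\<^sub>i\<^sub>-\<^sub>1\<close>, which preserves coefficientwise boundedness
  (\<open>quotient_coeffs_bounded\<close>).  The induction over the factors is \<open>higher_pderiv_near_roots_bigo\<close>.
\<close>

section \<open>Derivatives of polynomials close to many of their roots\<close>

lemma bigo_const_mult:
  fixes f :: "'k \<Rightarrow> 'a :: real_normed_field"
  assumes "f \<in> O[F](g)"
  shows "(\<lambda>x. c * f x) \<in> O[F](g)"
  using assms by (cases "c = 0") simp_all

lemma quotient_coeffs_bounded:
  fixes P Q :: "'k \<Rightarrow> 'a :: real_normed_field poly"
  assumes P: "\<And>i. (\<lambda>k. coeff (P k) i) \<in> O[F](\<lambda>_. 1)"
    and r: "r \<in> O[F](\<lambda>_. 1)"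
    and eq: "\<And>k. P k = [:1, r k:] * Q k"
  shows "(\<lambda>k. coeff (Q k) i) \<in> O[F](\<lambda>_. 1)"
proof (induction i)
  case 0
  have "coeff (Q k) 0 = coeff (P k) 0" for k
    by (simp add: eq)
  then show ?case using P[of 0] by simp
next
  case (Suc i)
  have "coeff (Q k) (Suc i) = coeff (P k) (Suc i) - r k * coeff (Q k) i" for k
    by (simp add: eq)
  moreover have "(\<lambda>k. r k * coeff (Q k) i) \<in> O[F](\<lambda>_. 1)"
    using landau_o.big.mult[OF r Suc.IH] by simp
  ultimately show ?case using sum_in_bigo(2)[OF P[of "Suc i"]] by simp
qed

lemma higher_pderiv_bounded:
  fixes P :: "'k \<Rightarrow> 'a :: real_normed_field poly"
  assumes deg: "\<And>k. degree (P k) \<le> D"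
    and coeffs: "\<And>i. (\<lambda>k. coeff (P k) i) \<in> O[F](\<lambda>_. 1)"
  shows "(\<lambda>k. poly ((pderiv ^^ \<beta>) (P k)) z) \<in> O[F](\<lambda>_. 1)"
proof -
  have "poly ((pderiv ^^ \<beta>) (P k)) z =
      (\<Sum>i\<le>D. pochhammer (of_nat (Suc i)) \<beta> * coeff (P k) (i + \<beta>) * z ^ i)" for k
  proof -
    have "degree ((pderiv ^^ \<beta>) (P k)) \<le> D"
      using deg[of k] by (simp add: degree_higher_pderiv)
    then have "poly ((pderiv ^^ \<beta>) (P k)) z = (\<Sum>i\<le>D. coeff ((pderiv ^^ \<beta>) (P k)) i * z ^ i)"
      unfolding poly_altdef
      by (intro sum.mono_neutral_left) (auto simp: not_le intro: coeff_eq_0)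
    then show ?thesis by (simp only: coeff_higher_pderiv)
  qed
  moreover have "(\<lambda>k. pochhammer (of_nat (Suc i)) \<beta> * coeff (P k) (i + \<beta>) * z ^ i) \<in> O[F](\<lambda>_. 1)"
    for i
    using landau_o.big.mult[OF landau_o.big.mult[OF _ coeffs[of "i + \<beta>"]],
        of "\<lambda>_. pochhammer (of_nat (Suc i)) \<beta>" "\<lambda>_. 1" "\<lambda>_. z ^ i" "\<lambda>_. 1"]
    by simp
  ultimately show ?thesis by (auto intro: big_sum_in_bigo)
qed

lemma higher_pderiv_linear_mult:
  fixes Q :: "'a :: {comm_ring_1, ring_no_zero_divisors} poly"
  shows "(pderiv ^^ \<beta>) ([:c, r:] * Q) =
    [:c, r:] * (pderiv ^^ \<beta>) Q + Polynomial.smult (of_nat \<beta> * r) ((pderiv ^^ (\<beta> - 1)) Q)"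
proof (induction \<beta>)
  case (Suc \<beta>)
  have product: "pderiv ([:c, r:] * R) = [:c, r:] * pderiv R + Polynomial.smult r R" for R :: "'a poly"
    by (simp only: pderiv_mult) (simp add: pderiv_pCons)
  have "Polynomial.smult (of_nat \<beta> * r) (pderiv ((pderiv ^^ (\<beta> - 1)) Q))
      = Polynomial.smult (of_nat \<beta> * r) ((pderiv ^^ \<beta>) Q)"
    by (cases \<beta>) auto
  then show ?case
    unfolding funpow.simps o_apply Suc.IH pderiv_add product pderiv_smult
    by (simp add: algebra_simps flip: smult_add_left)
qed simp

text \<open>
  The truncated exponent \<open>card I - \<beta>\<close> reads off how many small factors survive \<open>\<beta>\<close> derivatives.
  Peeling off one factor \<open>1 + r z\<close> with quotient \<open>Q\<close> leaves two terms: either the factor survives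
  and contributes one power of \<open>e\<close>, or it is differentiated away and \<open>Q\<close> carries one derivative
  less.  Either way at least the claimed power of \<open>e\<close> remains.
\<close>

lemma higher_pderiv_near_roots_bigo:
  fixes P :: "'k \<Rightarrow> 'a :: real_normed_field poly" and r :: "'i \<Rightarrow> 'k \<Rightarrow> 'a"
  assumes "finite I"
    and "\<And>k. degree (P k) \<le> D"
    and "\<And>i. (\<lambda>k. coeff (P k) i) \<in> O[F](\<lambda>_. 1)"
    and "\<And>i. i \<in> I \<Longrightarrow> r i \<in> O[F](\<lambda>_. 1)"
    and "\<And>i. i \<in> I \<Longrightarrow> (\<lambda>k. 1 + r i k * z) \<in> O[F](e)"
    and "\<And>k. (\<Prod>i\<in>I. [:1, r i k:]) dvd P k"
    and e: "e \<in> O[F](\<lambda>_. 1)"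
  shows "(\<lambda>k. poly ((pderiv ^^ \<beta>) (P k)) z) \<in> O[F](\<lambda>k. e k ^ (card I - \<beta>))"
  using assms(1-6)
proof (induction I arbitrary: P D \<beta> rule: finite_induct)
  case empty
  then show ?case using higher_pderiv_bounded[of P D F \<beta> z] by simp
next
  case (insert j I)
  note r = insert.prems(3) and near = insert.prems(4)
  have "\<exists>q. P k = [:1, r j k:] * q \<and> (\<Prod>i\<in>I. [:1, r i k:]) dvd q" for k
  proof -
    obtain s where "P k = (\<Prod>i\<in>insert j I. [:1, r i k:]) * s"
      using insert.prems(5)[of k] by (elim dvdE)
    then have "P k = [:1, r j k:] * ((\<Prod>i\<in>I. [:1, r i k:]) * s)"
      by (simp only: prod.insert[OF insert.hyps] mult.assoc)
    then show ?thesis by (meson dvd_triv_left)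
  qed
  then obtain Q where PQ: "\<And>k. P k = [:1, r j k:] * Q k"
    and dvd: "\<And>k. (\<Prod>i\<in>I. [:1, r i k:]) dvd Q k"
    by metis
  have degQ: "degree (Q k) \<le> D" for k
  proof (cases "Q k = 0")
    case False
    then have "degree (P k) = degree [:1, r j k:] + degree (Q k)"
      unfolding PQ by (intro degree_mult_eq) auto
    then show ?thesis using insert.prems(1)[of k] by linarith
  qed simp
  have coeffsQ: "(\<lambda>k. coeff (Q k) i) \<in> O[F](\<lambda>_. 1)" for i
    by (rule quotient_coeffs_bounded[OF insert.prems(2) r PQ]) simp
  have IH: "(\<lambda>k. poly ((pderiv ^^ \<beta>) (Q k)) z) \<in> O[F](\<lambda>k. e k ^ (card I - \<beta>))" for \<beta>
    by (rule insert.IH) (use degQ coeffsQ r near dvd in auto)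
  have survives: "(\<lambda>k. (1 + r j k * z) * poly ((pderiv ^^ \<beta>) (Q k)) z)
      \<in> O[F](\<lambda>k. e k ^ (Suc (card I) - \<beta>))"
  proof -
    have "(\<lambda>k. (1 + r j k * z) * poly ((pderiv ^^ \<beta>) (Q k)) z) \<in> O[F](\<lambda>k. e k * e k ^ (card I - \<beta>))"
      by (intro landau_o.big.mult near IH) simp
    also have "(\<lambda>k. e k * e k ^ (card I - \<beta>)) \<in> O[F](\<lambda>k. e k ^ (Suc (card I) - \<beta>))"
    proof (cases "\<beta> \<le> card I")
      case True
      then show ?thesis by (simp add: Suc_diff_le)
    next
      \<comment> \<open>the exponent on the right is truncated to \<open>0\<close>, so it is enough that \<open>e\<close> is bounded\<close>
      case False
      then show ?thesis using e by simp
    qed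
    finally show ?thesis .
  qed
  have differentiated: "(\<lambda>k. of_nat \<beta> * (r j k * poly ((pderiv ^^ (\<beta> - 1)) (Q k)) z))
      \<in> O[F](\<lambda>k. e k ^ (Suc (card I) - \<beta>))"
  proof (cases \<beta>)
    case (Suc b)
    have "(\<lambda>k. r j k * poly ((pderiv ^^ b) (Q k)) z) \<in> O[F](\<lambda>k. 1 * e k ^ (card I - b))"
      by (intro landau_o.big.mult r IH) simp
    then have "(\<lambda>k. of_nat \<beta> * (r j k * poly ((pderiv ^^ b) (Q k)) z))
        \<in> O[F](\<lambda>k. e k ^ (card I - b))"
      by (intro bigo_const_mult) simp
    then show ?thesis by (simp add: Suc)
  qed simp
  have "poly ((pderiv ^^ \<beta>) (P k)) z = (1 + r j k * z) * poly ((pderiv ^^ \<beta>) (Q k)) z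
      + of_nat \<beta> * (r j k * poly ((pderiv ^^ (\<beta> - 1)) (Q k)) z)" for k
    unfolding PQ higher_pderiv_linear_mult by (simp add: algebra_simps)
  then show ?case
    using sum_in_bigo(1)[OF survives differentiated] insert.hyps by simp
qed

section \<open>Laurent polynomials as shifted polynomials\<close>

definition laurent_numerator :: "nat \<Rightarrow> (int \<Rightarrow> complex) \<Rightarrow> complex poly" where
  "laurent_numerator m c = (\<Sum>j\<le>2 * m. monom (c (int j - int m)) j)"

lemma laurent_eval_eq_sum:
  assumes "\<And>i. c i \<noteq> 0 \<Longrightarrow> i \<in> {- int m..int m}"
  shows "laurent_eval c z = (\<Sum>i\<in>{- int m..int m}. c i * z powi i)"
  unfolding laurent_eval_def using assms by (intro sum.mono_neutral_left) auto

lemma poly_laurent_numerator: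
  assumes "\<And>i. c i \<noteq> 0 \<Longrightarrow> i \<in> {- int m..int m}" and "z \<noteq> 0"
  shows "poly (laurent_numerator m c) z = z ^ m * laurent_eval c z"
proof -
  have "z ^ m * laurent_eval c z = (\<Sum>i\<in>{- int m..int m}. c i * (z ^ m * z powi i))"
    by (simp add: laurent_eval_eq_sum[OF assms(1)] sum_distrib_left mult_ac)
  also have "\<dots> = (\<Sum>j\<le>2 * m. c (int j - int m) * z ^ j)"
  proof (rule sum.reindex_bij_witness[of _ "\<lambda>j. int j - int m" "\<lambda>i. nat (i + int m)"])
    fix i assume i: "i \<in> {- int m..int m}"
    then have "z ^ m * z powi i = z powi (int (nat (i + int m)))"
      using assms(2) by (simp add: power_int_add flip: power_int_of_nat)
    then show "c (int (nat (i + int m)) - int m) * z ^ nat (i + int m) = c i * (z ^ m * z powi i)"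
      using i by (simp only: power_int_of_nat) simp
  qed auto
  finally show ?thesis by (simp add: laurent_numerator_def poly_sum poly_monom)
qed

lemma degree_laurent_numerator: "degree (laurent_numerator m c) \<le> 2 * m"
  unfolding laurent_numerator_def by (intro degree_sum_le) (auto intro: order.trans[OF degree_monom_le])

lemma coeff_laurent_numerator:
  "coeff (laurent_numerator m c) i = (if i \<le> 2 * m then c (int i - int m) else 0)"
  by (simp add: laurent_numerator_def coeff_sum)

lemma dvd_monom_mult_cancel:
  fixes Q :: "'a :: idom poly"
  assumes "Q dvd monom 1 n * P" and "poly Q 0 \<noteq> 0"
  shows "Q dvd P"
  using assms(1)
proof (induction n)
  case (Suc n)
  obtain a R where "monom 1 (Suc n) * P = Q * pCons a R"
    using Suc.prems by (metis dvdE pCons_cases)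
  then have eq: "pCons 0 (monom 1 n * P) = Q * pCons a R"
    by (simp add: monom_Suc)
  then have "0 = poly (Q * pCons a R) 0"
    by (metis poly_pCons mult_zero_left add_0)
  then have "a = 0" using assms(2) by simp
  with eq have "monom 1 n * P = Q * R" by simp
  then show ?case using Suc.IH by simp
qed simp

text \<open>
  Clearing denominators turns the factorization into \<open>z\<^sup>n P = z\<^sup>m B Q\<close>; the power of \<open>z\<close> on
  the left can be cancelled because the constant term of \<open>Q\<close> does not vanish.
\<close>

lemma dvd_laurent_numerator:
  assumes c: "\<And>i. c i \<noteq> 0 \<Longrightarrow> i \<in> {- int m..int m}"
    and b: "finite {i. b i \<noteq> 0}"
    and fact: "\<And>z. z \<noteq> 0 \<Longrightarrow> laurent_eval c z = laurent_eval b z * poly Q z"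
    and Q: "poly Q 0 \<noteq> 0"
  shows "Q dvd laurent_numerator m c"
proof -
  obtain n where n: "\<And>i. b i \<noteq> 0 \<Longrightarrow> i \<in> {- int n..int n}"
  proof -
    define n where "n = (\<Sum>i | b i \<noteq> 0. nat \<bar>i\<bar>)"
    have "nat \<bar>i\<bar> \<le> n" if "b i \<noteq> 0" for i
      unfolding n_def using b that by (intro member_le_sum) auto
    then show ?thesis by (intro that[of n]) fastforce
  qed
  define D where "D = monom 1 n * laurent_numerator m c - monom 1 m * laurent_numerator n b * Q"
  have "poly D z = 0" if "z \<noteq> 0" for z
    using that unfolding D_def
    by (simp add: poly_monom poly_laurent_numerator[OF c] poly_laurent_numerator[OF n] fact)
  then have "- {0} \<subseteq> {z. poly D z = 0}" by auto
  moreover have "infinite (- {0 :: complex})"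
    by (simp add: infinite_UNIV_char_0 finite_compl)
  ultimately have "D = 0"
    using poly_roots_finite[of D] finite_subset by blast
  then have eq: "monom 1 n * laurent_numerator m c = monom 1 m * laurent_numerator n b * Q"
    by (simp add: D_def)
  show ?thesis
    by (rule dvd_monom_mult_cancel[of Q n, OF _ Q]) (simp add: eq)
qed

lemma higher_deriv_poly: "(deriv ^^ n) (poly p) = poly ((pderiv ^^ n) p)"
  by (induction n) (auto intro!: DERIV_imp_deriv)

text \<open>
  By Leibniz' rule the factor \<open>z\<^sup>-\<^sup>m\<close> only mixes in derivatives of lower order, and these are
  smaller.
\<close>

lemma higher_deriv_laurent_near_roots_bigo:
  fixes c :: "'k \<Rightarrow> int \<Rightarrow> complex" and r :: "'i \<Rightarrow> 'k \<Rightarrow> complex"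
  assumes supp: "\<And>k i. c k i \<noteq> 0 \<Longrightarrow> i \<in> {- int m..int m}"
    and bounded: "\<And>i. (\<lambda>k. c k i) \<in> O[F](\<lambda>_. 1)"
    and I: "finite I"
    and r: "\<And>i. i \<in> I \<Longrightarrow> r i \<in> O[F](\<lambda>_. 1)"
    and near: "\<And>i. i \<in> I \<Longrightarrow> (\<lambda>k. 1 + r i k * z) \<in> O[F](e)"
    and e: "e \<in> O[F](\<lambda>_. 1)"
    and fact: "\<And>k. \<exists>b. finite {i. b i \<noteq> 0} \<and>
        (\<forall>z. z \<noteq> 0 \<longrightarrow> laurent_eval (c k) z = laurent_eval b z * (\<Prod>i\<in>I. 1 + r i k * z))"
    and z: "z \<noteq> 0"
  shows "(\<lambda>k. (deriv ^^ \<beta>) (laurent_eval (c k)) z) \<in> O[F](\<lambda>k. e k ^ (card I - \<beta>))"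
proof -
  define P where "P k = laurent_numerator m (c k)" for k
  define u :: "complex \<Rightarrow> complex" where "u w = w powi (- int m)" for w
  have dvd: "(\<Prod>i\<in>I. [:1, r i k:]) dvd P k" for k
  proof -
    obtain b where b: "finite {i. b i \<noteq> 0}"
      "\<And>z. z \<noteq> 0 \<Longrightarrow> laurent_eval (c k) z = laurent_eval b z * (\<Prod>i\<in>I. 1 + r i k * z)"
      using fact by blast
    show ?thesis
      unfolding P_def
      by (rule dvd_laurent_numerator[OF supp b(1)]) (auto simp: b(2) poly_prod mult.commute)
  qed
  have coeffs: "(\<lambda>k. coeff (P k) i) \<in> O[F](\<lambda>_. 1)" for i
    by (cases "i \<le> 2 * m") (simp_all add: P_def coeff_laurent_numerator bounded)
  have P_bigo: "(\<lambda>k. poly ((pderiv ^^ b) (P k)) z) \<in> O[F](\<lambda>k. e k ^ (card I - b))" for b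
    by (rule higher_pderiv_near_roots_bigo[where D = "2 * m" and r = r, OF I _ coeffs r near dvd e])
      (auto simp: P_def degree_laurent_numerator)
  have Leibniz: "(deriv ^^ \<beta>) (laurent_eval (c k)) z = (\<Sum>i = 0..\<beta>. of_nat (\<beta> choose i) *
      (deriv ^^ i) u z * poly ((pderiv ^^ (\<beta> - i)) (P k)) z)" for k
  proof -
    have "laurent_eval (c k) w = u w * poly (P k) w" if "w \<noteq> 0" for w
      using that unfolding P_def u_def
      by (simp add: poly_laurent_numerator[OF supp] power_int_minus)
    then have "(deriv ^^ \<beta>) (laurent_eval (c k)) z = (deriv ^^ \<beta>) (\<lambda>w. u w * poly (P k) w) z"
      by (intro higher_deriv_cong_ev) (use t1_space_nhds[OF z] in \<open>auto elim: eventually_mono\<close>)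
    moreover have "u holomorphic_on - {0}"
      unfolding u_def by (intro holomorphic_intros) auto
    ultimately show ?thesis
      using z by (subst (asm) higher_deriv_mult[where S = "- {0}"])
        (auto intro!: holomorphic_intros simp: higher_deriv_poly)
  qed
  have "(\<lambda>k. of_nat (\<beta> choose i) * (deriv ^^ i) u z * poly ((pderiv ^^ (\<beta> - i)) (P k)) z)
      \<in> O[F](\<lambda>k. e k ^ (card I - \<beta>))" for i
  proof -
    have "(\<lambda>k. poly ((pderiv ^^ (\<beta> - i)) (P k)) z) \<in> O[F](\<lambda>k. e k ^ (card I - (\<beta> - i)))"
      by (rule P_bigo)
    also have "(\<lambda>k. e k ^ (card I - (\<beta> - i))) \<in> O[F](\<lambda>k. e k ^ (card I - \<beta>))"
    proof -
      define d where "d = (card I - (\<beta> - i)) - (card I - \<beta>)"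
      have "card I - (\<beta> - i) = (card I - \<beta>) + d" by (simp add: d_def)
      then show ?thesis
        using landau_o.big.mult[OF landau_o.big_refl landau_o.big_power[OF e, of d],
            of "\<lambda>k. e k ^ (card I - \<beta>)"]
        by (simp add: power_add)
    qed
    finally show ?thesis
      by (rule bigo_const_mult)
  qed
  then show ?thesis unfolding Leibniz by (intro big_sum_in_bigo)
qed

section \<open>Masks of an asymptotically stationary scheme\<close>

lemma asymptotically_similar_bounded:
  assumes "asymptotically_similar A a"
  shows "(\<lambda>k. complex_of_real (A k i)) \<in> O(\<lambda>_. 1)"
proof -
  have "\<forall>\<^sub>F k in sequentially. (SUP i. ennreal \<bar>A k i - a i\<bar>) < 1"
    using assms unfolding asymptotically_similar_def by (rule order_tendstoD) simp
  then have "\<forall>\<^sub>F k in sequentially. norm (complex_of_real (A k i)) \<le> (\<bar>a i\<bar> + 1) * norm (1 :: complex)"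
  proof eventually_elim
    case (elim k)
    have "ennreal \<bar>A k i - a i\<bar> \<le> (SUP i. ennreal \<bar>A k i - a i\<bar>)"
      by (rule SUP_upper) simp
    then have "ennreal \<bar>A k i - a i\<bar> < ennreal 1"
      using elim by (simp only: ennreal_1)
    then have "\<bar>A k i - a i\<bar> < 1"
      by (metis ennreal_less_iff abs_ge_zero)
    then show ?case by simp
  qed
  then show ?thesis by (rule bigoI)
qed

lemma norm_dyadic_power: "norm (complex_of_real (1 / 2 ^ k) ^ m) = 2 powr (- (real k * real m))"
proof -
  have "2 powr (real k * real m) = (2 :: real) ^ (k * m)"
    by (simp flip: powr_realpow)
  then show ?thesis
    by (simp add: norm_power norm_divide powr_minus power_mult norm_inverse power_inverse
        divide_inverse)
qed

lemma exp_dyadic_minus_1_bigo: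
  "(\<lambda>k. exp (w / 2 ^ (k + 1)) - 1) \<in> O(\<lambda>k. complex_of_real (1 / 2 ^ k))"
proof -
  have "(\<lambda>k. norm w * (1 / 2) ^ (k + 1)) \<longlonglongrightarrow> norm w * 0"
    by (intro tendsto_intros LIMSEQ_power_zero[THEN LIMSEQ_ignore_initial_segment]) auto
  then have "\<forall>\<^sub>F k in sequentially. norm w * (1 / 2) ^ (k + 1) < 1 / 2"
    by (rule order_tendstoD) simp
  then have "\<forall>\<^sub>F k in sequentially.
      norm (exp (w / 2 ^ (k + 1)) - 1) \<le> norm w * norm (complex_of_real (1 / 2 ^ k))"
  proof eventually_elim
    case (elim k)
    then have "norm (w / 2 ^ (k + 1)) \<le> 1 / 2"
      by (simp add: norm_divide norm_power power_one_over divide_simps)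
    then have "norm (exp (w / 2 ^ (k + 1)) - 1) \<le> 3 / 2 * norm (w / 2 ^ (k + 1))"
      by (rule norm_exp_bounds)
    also have "\<dots> \<le> norm w * norm (complex_of_real (1 / 2 ^ k))"
      by (simp add: norm_divide norm_power field_simps)
    finally show ?case .
  qed
  then show ?thesis by (rule bigoI)
qed

text \<open>
  On the points \<open>exp (w / 2\<^sup>k\<^sup>+\<^sup>1)\<close> each monomial \<open>z\<^sup>i\<close> is again of the form \<open>exp (i w / 2\<^sup>k\<^sup>+\<^sup>1)\<close>,
  so the increments of a symbol from \<open>1\<close> reduce to those of the exponential, term by term.
\<close>

lemma mask_symbol_dyadic_increment_bigo:
  assumes supp: "\<And>k i. A k i \<noteq> 0 \<Longrightarrow> i \<in> {- int M..int M}"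
    and bounded: "\<And>i. (\<lambda>k. complex_of_real (A k i)) \<in> O(\<lambda>_. 1)"
  shows "(\<lambda>k. mask_symbol (A k) (exp (w / 2 ^ (k + 1))) - mask_symbol (A k) 1)
    \<in> O(\<lambda>k. complex_of_real (1 / 2 ^ k))"
proof -
  have sym: "mask_symbol (A k) z = (\<Sum>i\<in>{- int M..int M}. of_real (A k i) * z powi i)" for k z
    unfolding mask_symbol_def by (rule laurent_eval_eq_sum) (use supp in auto)
  have "(\<lambda>k. of_real (A k i) * (exp (of_int i * w / 2 ^ (k + 1)) - 1))
      \<in> O(\<lambda>k. 1 * complex_of_real (1 / 2 ^ k))" for i
    by (intro landau_o.big.mult bounded exp_dyadic_minus_1_bigo)
  then have "(\<lambda>k. \<Sum>i\<in>{- int M..int M}. of_real (A k i) * (exp (of_int i * w / 2 ^ (k + 1)) - 1))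
      \<in> O(\<lambda>k. complex_of_real (1 / 2 ^ k))"
    by (intro big_sum_in_bigo) simp
  moreover have "mask_symbol (A k) (exp (w / 2 ^ (k + 1))) - mask_symbol (A k) 1 =
      (\<Sum>i\<in>{- int M..int M}. of_real (A k i) * (exp (of_int i * w / 2 ^ (k + 1)) - 1))" for k
    by (simp add: sym exp_power_int sum_subtractf algebra_simps)
  ultimately show ?thesis by simp
qed

theorem theorem13:
  fixes A :: "nat \<Rightarrow> int \<Rightarrow> real" and a :: "int \<Rightarrow> real" and M :: nat and p :: real
    and \<eta> N :: nat and lam :: "nat \<Rightarrow> complex" and \<mu> :: "nat \<Rightarrow> nat"
    and \<phi> :: "nat \<Rightarrow> real \<Rightarrow> complex"
  assumes "\<And>k i. A k i \<noteq> 0 \<Longrightarrow> i \<in> {- int M..int M}"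
    and "\<And>i. a i \<noteq> 0 \<Longrightarrow> i \<in> {- int M..int M}"
    and "p \<in> {0, - 1 / 2}"
    and "N = (\<Sum>n=1..\<eta>. \<mu> n)"
    and "cfun_independent (exp_monoms \<eta> lam \<mu>)"
    and "bij_betw \<phi> {..<N} (exp_monoms \<eta> lam \<mu>)"
    and "generating A p \<eta> lam \<mu>"
    and "reproduces_one A p \<eta> lam \<mu>"
    and "asymptotically_similar A a"
    and "subdiv_convergent (\<lambda>_. a)"
    and "\<forall>\<^sub>F x in nhds 0. invertible_mat (wronskian N \<phi> x)"
  shows "(\<lambda>k. cmod (mask_symbol (A k) 1 - 2)) \<in> O(\<lambda>k. 2 powr (- real k)) \<and>
    (\<forall>\<beta><N. (\<lambda>k. cmod ((deriv ^^ \<beta>) (mask_symbol (A k)) (- 1)))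
       \<in> O(\<lambda>k. 2 powr (- (real k * real (N - \<beta>)))))"
proof (intro conjI allI impI)
  let ?e = "\<lambda>k. complex_of_real (1 / 2 ^ k)"
  have bounded: "(\<lambda>k. complex_of_real (A k i)) \<in> O(\<lambda>_. 1)" for i
    using assms(9) by (rule asymptotically_similar_bounded)
  show "(\<lambda>k. cmod (mask_symbol (A k) 1 - 2)) \<in> O(\<lambda>k. 2 powr (- real k))"
  proof -
    obtain n where n: "\<And>k. mask_symbol (A k) (inverse (exp (lam n / 2 ^ (k + 1)))) =
        2 * exp (- of_real p * lam n / 2 ^ (k + 1))"
      using assms(8) unfolding reproduces_one_def by blast
    have "(\<lambda>k. 2 * (exp (- of_real p * lam n / 2 ^ (k + 1)) - 1)) \<in> O(?e)"
      by (intro bigo_const_mult exp_dyadic_minus_1_bigo)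
    then have "(\<lambda>k. 2 * (exp (- of_real p * lam n / 2 ^ (k + 1)) - 1)
        - (mask_symbol (A k) (exp (- lam n / 2 ^ (k + 1))) - mask_symbol (A k) 1)) \<in> O(?e)"
      by (rule sum_in_bigo(2))
        (rule mask_symbol_dyadic_increment_bigo[OF assms(1) bounded])
    moreover have "mask_symbol (A k) (exp (- lam n / 2 ^ (k + 1))) =
        2 * exp (- of_real p * lam n / 2 ^ (k + 1))" for k
      using n[of k] by (simp add: exp_minus)
    ultimately have "(\<lambda>k. mask_symbol (A k) 1 - 2) \<in> O(?e)"
      by (simp add: algebra_simps)
    then have "(\<lambda>k. cmod (mask_symbol (A k) 1 - 2)) \<in> O(\<lambda>k. norm (?e k))"
      by (simp only: landau_o.big.norm_iff)
    then show ?thesis using norm_dyadic_power[of _ 1] by (simp only: power_one_right of_nat_1 mult_1_right)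
  qed

  fix \<beta> assume "\<beta> < N"
  define I where "I = (SIGMA n:{1..\<eta>}. {..<\<mu> n})"
  define r where "r i k = exp (lam (fst i) / 2 ^ (k + 1))" for i :: "nat \<times> nat" and k
  have e: "?e \<in> O(\<lambda>_. 1)"
    by (intro bigoI[of _ 1]) (simp add: norm_divide norm_power)
  have near: "(\<lambda>k. 1 + r i k * - 1) \<in> O(?e)" for i
    using exp_dyadic_minus_1_bigo[of "lam (fst i)"]
      landau_o.big.uminus_in_iff[of "\<lambda>k. r i k - 1"] by (simp add: r_def)
  have r_bounded: "r i \<in> O(\<lambda>_. 1)" for i
    using sum_in_bigo(2)[OF _ landau_o.big.trans[OF near e], of "\<lambda>_. 1"] by simp
  \<comment> \<open>the factors with their multiplicities, as an indexed family of linear factors\<close>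
  have prod_I: "(\<Prod>i\<in>I. 1 + r i k * z) = (\<Prod>n=1..\<eta>. (1 + exp (lam n / 2 ^ (k + 1)) * z) ^ \<mu> n)"
    for k z
  proof -
    have "(\<Prod>i\<in>I. 1 + r i k * z) = (\<Prod>n=1..\<eta>. \<Prod>j<\<mu> n. 1 + r (n, j) k * z)"
      unfolding I_def by (subst prod.Sigma) auto
    then show ?thesis by (simp add: r_def)
  qed
  have card_I: "card I = N"
    using assms(4) by (simp add: I_def)
  have "(\<lambda>k. (deriv ^^ \<beta>) (mask_symbol (A k)) (- 1)) \<in> O(\<lambda>k. ?e k ^ (card I - \<beta>))"
    unfolding mask_symbol_def
  proof (rule higher_deriv_laurent_near_roots_bigo[where r = r and m = M])
    show "finite I" by (simp add: I_def)
    show "\<exists>b. finite {i. b i \<noteq> 0} \<and> (\<forall>z. z \<noteq> 0 \<longrightarrow> laurent_eval (\<lambda>i. of_real (A k i)) z =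
        laurent_eval b z * (\<Prod>i\<in>I. 1 + r i k * z))" for k
      using assms(7) unfolding prod_I generating_def mask_symbol_def by blast
  qed (use assms(1) bounded near r_bounded e in auto)
  then have "(\<lambda>k. cmod ((deriv ^^ \<beta>) (mask_symbol (A k)) (- 1)))
      \<in> O(\<lambda>k. norm (?e k ^ (N - \<beta>)))"
    unfolding card_I by (simp only: landau_o.big.norm_iff)
  then show "(\<lambda>k. cmod ((deriv ^^ \<beta>) (mask_symbol (A k)) (- 1)))
      \<in> O(\<lambda>k. 2 powr (- (real k * real (N - \<beta>))))"
    by (simp only: norm_dyadic_power)
qed

end
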